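(* Let $X=\{x,z\}\cup\{y_n\mid n\ge 1\}$ (all listed elements distinct), partially ordered so that $x$ is the least element, $z$ is the greatest element, and the $y_n$ are pairwise incomparable. Topologize $X$ as the one-point compactification of the discrete space $X\setminus\{x\}$ with $x$ the point at infinity (so the clopen sets are the finite sets not containing $x$ and the cofinite sets containing $x$); this makes $X$ a Priestley space. Let $\mathcal{C}$ be the set of convex closed subsets of $X$. Then $\mathcal{C}$ is not closed in $\mathcal{F}^{\Diamond\Box}$; consequently $\mathcal{C}$ with the hit-or-miss topology (the subspace topology from $\mathcal{F}^{\Diamond\Box}$) is not compact, and the hit-or-miss topology on $\mathcal{C}$ is strictly stronger (finer) than the weak hit-or-miss topology on $\mathcal{C}$.
   Context: $\mathcal{F}$ is the set of all closed subsets of $X$ (including $\varnothing$). For $U$ open and $K$ compact in $X$ let $\Diamond_U=\{C\in\mathcal{F}\mid C\cap U\neq\varnothing\}$ and $\Box_K=\{C\in\mathcal{F}\mid C\cap K=\varnothing\}$. $\mathcal{F}^{\Diamond\Box}$ is $\mathcal{F}$ with the topology generated by all $\Diamond_U$ and $\Box_K$. A set $C\subseteq X$ is convex if $p,q\in C$ and $p\le r\le q$ imply $r\in C$. The weak hit-or-miss topology on $\mathcal{C}$ is generated by the restrictions to $\mathcal{C}$ of the sets $\Box_{V},\Box_{V^c},\Diamond_{V},\Diamond_{V^c}$ where $V$ ranges over the clopen upsets of $X$ and $V^c=X\setminus V$. *)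

theory Defs
  imports "HOL-Analysis.Analysis"
begin

text \<open>
  An ordered topological space is given by a topology \<open>T\<close> and an order relation \<open>r\<close> on
  \<open>topspace T\<close>, where \<open>(p, q) \<in> r\<close> stands for \<open>p \<le> q\<close>.
\<close>

definition clopenin :: "'a topology \<Rightarrow> 'a set \<Rightarrow> bool" where
  "clopenin T V \<longleftrightarrow> openin T V \<and> closedin T V"

definition upset_in :: "'a set \<Rightarrow> 'a rel \<Rightarrow> 'a set \<Rightarrow> bool" where
  "upset_in X r U \<longleftrightarrow> U \<subseteq> X \<and> (\<forall>p\<in>U. \<forall>q\<in>X. (p, q) \<in> r \<longrightarrow> q \<in> U)"

definition convex_in :: "'a set \<Rightarrow> 'a rel \<Rightarrow> 'a set \<Rightarrow> bool" where
  "convex_in X r C \<longleftrightarrow>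
     C \<subseteq> X \<and> (\<forall>p\<in>C. \<forall>q\<in>C. \<forall>s\<in>X. (p, s) \<in> r \<and> (s, q) \<in> r \<longrightarrow> s \<in> C)"

definition priestley_space :: "'a topology \<Rightarrow> 'a rel \<Rightarrow> bool" where
  "priestley_space T r \<longleftrightarrow>
     compact_space T \<and> partial_order_on (topspace T) r \<and>
     (\<forall>p\<in>topspace T. \<forall>q\<in>topspace T. (p, q) \<notin> r \<longrightarrow>
        (\<exists>U. clopenin T U \<and> upset_in (topspace T) r U \<and> p \<in> U \<and> q \<notin> U))"

definition closed_subsets :: "'a topology \<Rightarrow> 'a set set" where
  "closed_subsets T = {C. closedin T C}"

definition hit :: "'a topology \<Rightarrow> 'a set \<Rightarrow> 'a set set" where
  "hit T U = {C \<in> closed_subsets T. C \<inter> U \<noteq> {}}"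

definition miss :: "'a topology \<Rightarrow> 'a set \<Rightarrow> 'a set set" where
  "miss T K = {C \<in> closed_subsets T. C \<inter> K = {}}"

text \<open>
  The underlying set of \<open>hit_or_miss_topology T\<close> is \<open>closed_subsets T\<close>, and that of
  \<open>weak_hit_or_miss_topology T r\<close> is \<open>convex_closed_subsets T r\<close>: the empty set is
  compact and a clopen upset, and \<open>miss T {} = closed_subsets T\<close>.
\<close>

definition hit_or_miss_topology :: "'a topology \<Rightarrow> 'a set topology" where
  "hit_or_miss_topology T =
     topology_generated_by ({hit T U | U. openin T U} \<union> {miss T K | K. compactin T K})"

definition convex_closed_subsets :: "'a topology \<Rightarrow> 'a rel \<Rightarrow> 'a set set" where
  "convex_closed_subsets T r = {C \<in> closed_subsets T. convex_in (topspace T) r C}"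

definition weak_hit_or_miss_topology :: "'a topology \<Rightarrow> 'a rel \<Rightarrow> 'a set topology" where
  "weak_hit_or_miss_topology T r =
     topology_generated_by
       (\<Union>V \<in> {V. clopenin T V \<and> upset_in (topspace T) r V}.
          {miss T V \<inter> convex_closed_subsets T r,
           miss T (topspace T - V) \<inter> convex_closed_subsets T r,
           hit T V \<inter> convex_closed_subsets T r,
           hit T (topspace T - V) \<inter> convex_closed_subsets T r})"

definition strictly_finer :: "'a topology \<Rightarrow> 'a topology \<Rightarrow> bool" where
  "strictly_finer S T \<longleftrightarrow>
     topspace S = topspace T \<and> (\<forall>U. openin T U \<longrightarrow> openin S U) \<and>
     (\<exists>U. openin S U \<and> \<not> openin T U)"

text \<open>
  \<open>Alexandroff_compactification D\<close> lives on an option type, with \<open>None\<close> as the point at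
  infinity; here it is carried over so that \<open>x\<close> is the point at infinity.
\<close>

definition one_point_compactification_at :: "'a \<Rightarrow> 'a topology \<Rightarrow> 'a topology \<Rightarrow> bool" where
  "one_point_compactification_at x D T \<longleftrightarrow>
     x \<notin> topspace D \<and>
     homeomorphic_map (Alexandroff_compactification D) T (case_option x (\<lambda>p. p))"

end

theory Submission
  imports Defs
begin

text \<open>
  The convex sets \<open>{y n, z}\<close> converge to the non-convex set \<open>{x, z}\<close> in the hit-or-miss
  topology, so the convex closed sets are not closed, and as that topology is Hausdorff, they
  are not compact. A nonempty clopen upset other than \<open>X\<close> is a finite set containing \<open>z\<close> but
  not \<open>x\<close>, so in the weak topology the same sequence converges to \<open>X\<close>, and it
  eventually leaves the hit-or-miss neighbourhood \<open>hit T {y 1}\<close> of \<open>X\<close>.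
\<close>

section \<open>Convergence in a generated topology\<close>

text \<open>Sets that the family enters eventually whenever they contain \<open>l\<close> are stable
  under finite intersections and arbitrary unions, so testing generators is enough. The assumption
  \<open>l \<in> \<Union>B\<close> places the limit in the underlying set.\<close>

lemma limitin_topology_generated_by:
  assumes l: "l \<in> \<Union>B"
    and sub: "\<And>U. U \<in> B \<Longrightarrow> l \<in> U \<Longrightarrow> eventually (\<lambda>i. f i \<in> U) F"
  shows "limitin (topology_generated_by B) f l F"
proof -
  have "eventually (\<lambda>i. f i \<in> U) F" if "generate_topology_on B U" "l \<in> U" for U
    using that
  proof (induction rule: generate_topology_on.induct)
    case Empty
    then show ?case by simp
  next
    case (Int a b)
    then show ?case by (simp add: eventually_conj)
  next
    case (UN K)
    then obtain k where k: "k \<in> K" "l \<in> k" by blast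
    then have "eventually (\<lambda>i. f i \<in> k) F" using UN by blast
    then show ?case by (rule eventually_mono) (use k in blast)
  next
    case (Basis s)
    then show ?case using sub by blast
  qed
  then show ?thesis
    using l by (simp add: limitin_def openin_topology_generated_by_iff topology_generated_by_topspace)
qed

section \<open>One-point compactifications of discrete spaces\<close>

lemma one_point_compactification_at_discrete_topspace:
  assumes "one_point_compactification_at x (discrete_topology S) T"
  shows "topspace T = insert x S"
proof -
  have "topspace T = case_option x (\<lambda>p. p) ` topspace (Alexandroff_compactification (discrete_topology S))"
    using assms homeomorphic_imp_surjective_map
    unfolding one_point_compactification_at_def by metis
  then show ?thesis by (auto simp: image_image)
qed

text \<open>Compact subsets of a discrete space are the finite ones, so the open neighbourhoods of
  infinity are the cofinite sets containing it. The homeomorphism carries this description over from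
  the option type.\<close>

lemma one_point_compactification_at_discrete_openin:
  assumes "one_point_compactification_at x (discrete_topology S) T"
  shows "openin T V \<longleftrightarrow> V \<subseteq> insert x S \<and> (x \<in> V \<longrightarrow> finite (S - V))"
proof (cases "V \<subseteq> insert x S")
  case False
  then show ?thesis
    using openin_subset one_point_compactification_at_discrete_topspace[OF assms] by metis
next
  case V: True
  define f where "f = case_option x (\<lambda>p::'a. p)"
  \<comment> \<open>\<open>W\<close> is the preimage of \<open>V\<close> in the compactification,
    with \<open>None\<close> standing for \<open>x\<close>.\<close>
  define W where "W = (if x \<in> V then insert None (Some ` (V - {x})) else Some ` V)"
  have hom: "homeomorphic_map (Alexandroff_compactification (discrete_topology S)) T f"
    and x: "x \<notin> S"
    using assms by (auto simp: one_point_compactification_at_def f_def)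
  have "f ` W = V"
    by (auto simp: W_def f_def image_image)
  moreover have "W \<subseteq> topspace (Alexandroff_compactification (discrete_topology S))"
    using V by (auto simp: W_def)
  ultimately have "openin T V \<longleftrightarrow> openin (Alexandroff_compactification (discrete_topology S)) W"
    using homeomorphic_map_openness[OF hom] by metis
  also have "\<dots> \<longleftrightarrow> (x \<in> V \<longrightarrow> finite (S - V))"
  proof (cases "x \<in> V")
    case True
    have eq: "insert None (Some ` (V - {x})) = insert None (Some ` (S - C)) \<longleftrightarrow> V - {x} = S - C" for C
      by (auto simp: set_eq_iff image_iff)
    \<comment> \<open>The removed compact set \<open>C\<close> can only be \<open>S - V\<close>,
      which turns the existential over \<open>C\<close> into finiteness of that set.\<close>
    have "V - {x} = S - (S - V)" using V x by auto
    moreover have "C = S - V" if "C \<subseteq> S" "V - {x} = S - C" for C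
      using that V x by blast
    ultimately have "(\<exists>C. C \<subseteq> S \<and> finite C \<and> V - {x} = S - C) \<longleftrightarrow> finite (S - V)"
      by (metis Diff_subset)
    moreover have "insert None (Some ` (V - {x})) \<noteq> Some ` U" for U
      by blast
    ultimately show ?thesis
      unfolding openin_Alexandroff_compactification
      by (simp add: W_def True eq compactin_discrete_topology conj_assoc conj_commute conj_left_commute)
  next
    case False
    then show ?thesis
      using V by (auto simp: W_def openin_Alexandroff_compactification)
  qed
  finally show ?thesis using V by simp
qed

lemma compact_space_one_point_compactification_at:
  assumes "one_point_compactification_at x D T"
  shows "compact_space T"
  using assms unfolding one_point_compactification_at_def
  by (meson compact_space_Alexandroff_compactification homeomorphic_compact_space homeomorphic_map_imp_homeomorphic_space)

text \<open>A finite subcover of the cover by open singletons exhausts \<open>K\<close>.\<close>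

lemma compactin_discrete_subset_imp_finite:
  assumes "compactin T K" and "\<And>p. p \<in> K \<Longrightarrow> openin T {p}"
  shows "finite K"
proof -
  obtain F where "finite F" "F \<subseteq> (\<lambda>p. {p}) ` K" "K \<subseteq> \<Union>F"
    using assms compactinD[of T K "(\<lambda>p. {p}) ` K"] by blast
  moreover have "finite (\<Union>F)"
    using calculation by (intro finite_Union) auto
  ultimately show ?thesis by (simp add: finite_subset)
qed

section \<open>Hausdorff separation of points and of closed sets\<close>

text \<open>By antisymmetry, distinct points are unrelated in at least one direction. The clopen
  upset given for that direction and its complement separate them.\<close>

lemma priestley_space_imp_Hausdorff_space:
  assumes "priestley_space T r"
  shows "Hausdorff_space T"
  unfolding Hausdorff_space_def
proof (intro allI impI)
  fix p q assume pq: "p \<in> topspace T \<and> q \<in> topspace T \<and> p \<noteq> q"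
  have sep: "\<exists>U V. openin T U \<and> openin T V \<and> a \<in> U \<and> b \<in> V \<and> disjnt U V"
    if ab: "a \<in> topspace T" "b \<in> topspace T" "(a, b) \<notin> r" for a b
  proof -
    obtain U where "clopenin T U" "a \<in> U" "b \<notin> U"
      using assms ab unfolding priestley_space_def by blast
    then show ?thesis
      using ab by (intro exI[of _ U] exI[of _ "topspace T - U"]) (auto simp: clopenin_def disjnt_def)
  qed
  have "(p, q) \<notin> r \<or> (q, p) \<notin> r"
    using assms pq by (auto simp: priestley_space_def partial_order_on_def dest: antisymD)
  then show "\<exists>U V. openin T U \<and> openin T V \<and> p \<in> U \<and> q \<in> V \<and> disjnt U V"
    using sep[of p q] sep[of q p] pq by (metis disjnt_sym)
qed

lemma topspace_hit_or_miss_topology: "topspace (hit_or_miss_topology T) = closed_subsets T"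
proof -
  have "miss T {} = closed_subsets T" by (auto simp: miss_def)
  moreover have "compactin T {}" by simp
  ultimately have "closed_subsets T \<in> {miss T K | K. compactin T K}" by blast
  then show ?thesis
    unfolding hit_or_miss_topology_def topology_generated_by_topspace
    by (auto simp: hit_def miss_def)
qed

lemma openin_hit: "openin T U \<Longrightarrow> openin (hit_or_miss_topology T) (hit T U)"
  unfolding hit_or_miss_topology_def by (rule topology_generated_by_Basis) blast

lemma openin_miss: "compactin T K \<Longrightarrow> openin (hit_or_miss_topology T) (miss T K)"
  unfolding hit_or_miss_topology_def by (rule topology_generated_by_Basis) blast

text \<open>If \<open>p\<close> lies in \<open>C\<close> but not in \<open>D\<close>, regularity
  gives an open \<open>U\<close> around \<open>p\<close> inside a closed, hence compact,
  \<open>K\<close> disjoint from \<open>D\<close>. No set can both hit \<open>U\<close> and miss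
  \<open>K\<close>, so \<open>hit T U\<close> and \<open>miss T K\<close> separate \<open>C\<close>
  from \<open>D\<close>.\<close>

lemma Hausdorff_space_hit_or_miss_topology:
  assumes "compact_space T" "Hausdorff_space T"
  shows "Hausdorff_space (hit_or_miss_topology T)"
proof -
  have sep: "\<exists>U V. openin (hit_or_miss_topology T) U \<and> openin (hit_or_miss_topology T) V \<and>
               C \<in> U \<and> D \<in> V \<and> disjnt U V"
    if CD: "closedin T C" "closedin T D" "p \<in> C" "p \<notin> D" for C D p
  proof -
    have "regular_space T"
      using assms compact_Hausdorff_imp_regular_space by blast
    moreover have "p \<in> topspace T - D"
      using CD closedin_subset by blast
    ultimately obtain U K where UK: "openin T U" "closedin T K" "p \<in> U" "U \<subseteq> K" "K \<subseteq> topspace T - D"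
      using CD(2) neighbourhood_base_of_closedin[of T] openin_diff[OF openin_topspace CD(2)]
      unfolding neighbourhood_base_of by metis
    have "compactin T K"
      using UK(2) assms(1) closedin_compact_space by blast
    then show ?thesis
      using UK CD openin_hit[of T U] openin_miss[of T K]
      by (intro exI[of _ "hit T U"] exI[of _ "miss T K"])
        (auto simp: hit_def miss_def closed_subsets_def disjnt_def)
  qed
  show ?thesis
    unfolding Hausdorff_space_def topspace_hit_or_miss_topology
  proof (intro allI impI)
    fix C D assume CD: "C \<in> closed_subsets T \<and> D \<in> closed_subsets T \<and> C \<noteq> D"
    then have cl: "closedin T C" "closedin T D" by (auto simp: closed_subsets_def)
    obtain p where "p \<in> C \<and> p \<notin> D \<or> p \<in> D \<and> p \<notin> C" using CD by blast
    then show "\<exists>U V. openin (hit_or_miss_topology T) U \<and> openin (hit_or_miss_topology T) V \<and>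
               C \<in> U \<and> D \<in> V \<and> disjnt U V"
      using sep[of C D p] sep[of D C p] cl by (metis disjnt_sym)
  qed
qed

section \<open>The weak topology compared with the hit-or-miss topology\<close>

lemma topspace_weak_hit_or_miss_topology:
  "topspace (weak_hit_or_miss_topology T r) = convex_closed_subsets T r"
proof -
  have "clopenin T {}" "upset_in (topspace T) r {}"
    by (auto simp: clopenin_def upset_in_def)
  moreover have "convex_closed_subsets T r \<subseteq> miss T {} \<inter> convex_closed_subsets T r"
    by (auto simp: miss_def convex_closed_subsets_def)
  ultimately show ?thesis
    unfolding weak_hit_or_miss_topology_def topology_generated_by_topspace by blast
qed

text \<open>In a compact space a clopen set and its complement are both open and compact, so every
  weak generator is the trace of a \<open>hit\<close> or \<open>miss\<close> generator.\<close>

lemma openin_weak_imp_openin_hit_or_miss: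
  assumes "compact_space T" and "openin (weak_hit_or_miss_topology T r) W"
  shows "openin (subtopology (hit_or_miss_topology T) (convex_closed_subsets T r)) W"
proof -
  let ?S = "subtopology (hit_or_miss_topology T) (convex_closed_subsets T r)"
  have sub: "openin ?S (A \<inter> convex_closed_subsets T r)" if "openin (hit_or_miss_topology T) A" for A
    using that by (auto simp: openin_subtopology)
  have clopen: "openin T V \<and> openin T (topspace T - V) \<and> compactin T V \<and> compactin T (topspace T - V)"
    if "clopenin T V" for V
    using that assms(1) closedin_compact_space unfolding clopenin_def
    by (metis closedin_diff closedin_topspace openin_diff openin_topspace)
  show ?thesis
    using assms(2)[unfolded weak_hit_or_miss_topology_def openin_topology_generated_by_iff]
  proof (induction rule: generate_topology_on.induct)
    case (Basis s)
    then show ?case using clopen sub openin_hit openin_miss by blast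
  qed auto
qed

theorem mainTheorem6:
  fixes x z :: 'a and y :: "nat \<Rightarrow> 'a" and X :: "'a set"
    and r :: "'a rel" and T :: "'a topology"
  assumes X: "X = {x, z} \<union> {y n | n. n \<ge> 1}"
    and distinct: "x \<noteq> z" "\<And>n. n \<ge> 1 \<Longrightarrow> y n \<noteq> x" "\<And>n. n \<ge> 1 \<Longrightarrow> y n \<noteq> z" "inj_on y {1..}"
    and order: "partial_order_on X r"
    and least: "\<And>p. p \<in> X \<Longrightarrow> (x, p) \<in> r"
    and greatest: "\<And>p. p \<in> X \<Longrightarrow> (p, z) \<in> r"
    and incomparable: "\<And>m n. m \<ge> 1 \<Longrightarrow> n \<ge> 1 \<Longrightarrow> m \<noteq> n \<Longrightarrow> (y m, y n) \<notin> r"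
    and topology: "one_point_compactification_at x (discrete_topology (X - {x})) T"
  shows "(\<forall>V. clopenin T V \<longleftrightarrow>
            V \<subseteq> X \<and> (finite V \<and> x \<notin> V \<or> finite (X - V) \<and> x \<in> V)) \<and>
         priestley_space T r \<and>
         \<not> closedin (hit_or_miss_topology T) (convex_closed_subsets T r) \<and>
         \<not> compact_space (subtopology (hit_or_miss_topology T) (convex_closed_subsets T r)) \<and>
         strictly_finer (subtopology (hit_or_miss_topology T) (convex_closed_subsets T r))
                        (weak_hit_or_miss_topology T r)"
proof -
  let ?H = "hit_or_miss_topology T" and ?C = "convex_closed_subsets T r"

  \<comment> \<open>Topology and order of the space \<open>X\<close>\<close>
  have mem: "x \<in> X" "z \<in> X" "\<And>n. n \<ge> 1 \<Longrightarrow> y n \<in> X"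
    using X by auto
  have top: "topspace T = X"
    using one_point_compactification_at_discrete_topspace[OF topology] mem by auto
  have op: "openin T V \<longleftrightarrow> V \<subseteq> X \<and> (x \<in> V \<longrightarrow> finite (X - V))" for V
  proof -
    have "X - {x} - V = X - V" if "x \<in> V" using that by auto
    then show ?thesis
      using one_point_compactification_at_discrete_openin[OF topology, of V] mem by (auto simp: insert_absorb)
  qed
  have cl: "closedin T V \<longleftrightarrow> V \<subseteq> X \<and> (x \<notin> V \<longrightarrow> finite V)" for V
    using mem by (auto simp: closedin_def op top double_diff)
  have clopen: "clopenin T V \<longleftrightarrow> V \<subseteq> X \<and> (finite V \<and> x \<notin> V \<or> finite (X - V) \<and> x \<in> V)" for V
    by (auto simp: clopenin_def op cl)
  have refl: "(p, p) \<in> r" if "p \<in> X" for p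
    using order that by (auto simp: partial_order_on_def preorder_on_def refl_on_def)
  have anti: "p = q" if "(p, q) \<in> r" "(q, p) \<in> r" for p q
    using order that by (auto simp: partial_order_on_def dest: antisymD)
  have compact: "compact_space T"
    using compact_space_one_point_compactification_at[OF topology] .
  have above_x: "p = x" if "(p, x) \<in> r" "p \<in> X" for p
    using anti least that by blast
  have below_z: "p = z" if "(z, p) \<in> r" "p \<in> X" for p
    using anti greatest that by blast
  \<comment> \<open>Going up from some \<open>y n\<close>, the point \<open>x\<close> is excluded by
    antisymmetry and every other \<open>y m\<close> by incomparability.\<close>
  have above: "s = p \<or> s = z" if s: "(p, s) \<in> r" "p \<in> X" "p \<noteq> x" "s \<in> X" for p s
    using s X above_x below_z incomparable by blast
  have priestley: "priestley_space T r"
    unfolding priestley_space_def top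
  proof (intro conjI ballI impI)
    fix p q assume pq: "p \<in> X" "q \<in> X" "(p, q) \<notin> r"
    then have ne: "p \<noteq> x" "q \<noteq> p" "q \<noteq> z" using least greatest refl by auto
    \<comment> \<open>\<open>{p, z}\<close> is the smallest upset containing \<open>p\<close>. It is
      finite and avoids \<open>x\<close>, hence clopen.\<close>
    have "upset_in X r {p, z}"
      using above[of p] below_z pq(1) ne mem by (auto simp: upset_in_def)
    then show "\<exists>U. clopenin T U \<and> upset_in X r U \<and> p \<in> U \<and> q \<notin> U"
      using ne pq mem distinct(1) by (intro exI[of _ "{p, z}"]) (auto simp: clopen)
  qed (use order compact in auto)
  \<comment> \<open>Finite sets are closed, and by \<open>above\<close> no third point lies above
    \<open>y n\<close> or \<open>z\<close>.\<close>
  have conv: "{y n, z} \<in> ?C" if "n \<ge> 1" for n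
    using mem(2) mem(3)[OF that] above[of "y n"] below_z distinct(1) distinct(2)[OF that]
    by (auto simp: convex_closed_subsets_def closed_subsets_def cl convex_in_def top)
  have nconv: "{x, z} \<notin> ?C"
  proof -
    \<comment> \<open>\<open>y 1\<close> lies between \<open>x\<close> and \<open>z\<close> and so
      witnesses the failure of convexity.\<close>
    have "y 1 \<in> X" "y 1 \<notin> {x, z}"
      using mem(3)[of 1] distinct(2,3)[of 1] by auto
    then show ?thesis
      using least greatest by (auto simp: convex_closed_subsets_def convex_in_def top)
  qed
  have XC: "X \<in> ?C"
    using mem by (auto simp: convex_closed_subsets_def closed_subsets_def cl convex_in_def top)
  have conv_ev: "eventually (\<lambda>n. {y n, z} \<in> ?C) sequentially"
    using conv eventually_ge_at_top[of 1] by (rule eventually_mono[rotated])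
  \<comment> \<open>Injectivity lets \<open>y\<close> enter a finite set only finitely often. It
    holds from index 1 on and \<open>y 0\<close> is arbitrary, so index 0 is discarded.\<close>
  have avoid: "eventually (\<lambda>n. y n \<notin> F) sequentially" if "finite F" for F
  proof -
    have "finite {n \<in> {1..}. y n \<in> F}"
      using finite_vimage_IntI[OF that distinct(4)] by (auto simp: vimage_def Int_def conj_commute)
    then have "eventually (\<lambda>n. n \<notin> {n \<in> {1..}. y n \<in> F}) sequentially"
      by (simp add: eventually_cofinite flip: cofinite_eq_sequentially)
    then show ?thesis
      using eventually_ge_at_top[of 1] by eventually_elim auto
  qed

  \<comment> \<open>Failure of closedness and compactness in the hit-or-miss topology\<close>
  have lim: "limitin ?H (\<lambda>n. {y n, z}) {x, z} sequentially"
    unfolding hit_or_miss_topology_def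
  proof (rule limitin_topology_generated_by)
    show "{x, z} \<in> \<Union> ({hit T U |U. openin T U} \<union> {miss T K |K. compactin T K})"
      using topspace_hit_or_miss_topology[of T] mem
      unfolding hit_or_miss_topology_def topology_generated_by_topspace
      by (simp add: closed_subsets_def cl)
  next
    fix S assume S: "S \<in> {hit T U |U. openin T U} \<union> {miss T K |K. compactin T K}" and l: "{x, z} \<in> S"
    have closed_ev: "eventually (\<lambda>n. {y n, z} \<in> closed_subsets T) sequentially"
      using conv_ev by eventually_elim (simp add: convex_closed_subsets_def)
    from S show "eventually (\<lambda>n. {y n, z} \<in> S) sequentially"
    proof
      assume "S \<in> {hit T U |U. openin T U}"
      then obtain U where U: "S = hit T U" "openin T U" by blast
      show ?thesis
      \<comment> \<open>If \<open>z\<close> is in \<open>U\<close>, every pair hits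
        \<open>U\<close>. Otherwise the limit hits \<open>U\<close> at \<open>x\<close>, so
        \<open>U\<close> is cofinite and contains \<open>y n\<close> for large
        \<open>n\<close>.\<close>
      proof (cases "z \<in> U")
        case True
        from closed_ev show ?thesis by eventually_elim (simp add: U hit_def True)
      next
        case False
        then have "finite (X - U)" using l U by (auto simp: hit_def op)
        from avoid[OF this] closed_ev eventually_ge_at_top[of 1] show ?thesis
          by eventually_elim (use mem in \<open>auto simp: U hit_def\<close>)
      qed
    next
      assume "S \<in> {miss T K |K. compactin T K}"
      then obtain K where K: "S = miss T K" "compactin T K" by blast
      then have xz: "x \<notin> K" "z \<notin> K" using l by (auto simp: miss_def)
      \<comment> \<open>Since \<open>x\<close> is not in \<open>K\<close>, all points of
        \<open>K\<close> are isolated, so compactness forces finiteness.\<close>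
      have "finite K"
        using K(2)
      proof (rule compactin_discrete_subset_imp_finite)
        show "openin T {p}" if "p \<in> K" for p
          using that xz compactin_subset_topspace[OF K(2)] by (auto simp: op top)
      qed
      from avoid[OF this] closed_ev show ?thesis
        by eventually_elim (use xz in \<open>auto simp: K miss_def\<close>)
    qed
  qed
  have not_closed: "\<not> closedin ?H ?C"
    using limitin_closedin[OF lim _ conv_ev] nconv by auto

  have "Hausdorff_space ?H"
    using Hausdorff_space_hit_or_miss_topology compact priestley_space_imp_Hausdorff_space[OF priestley] .
  then have not_compact: "\<not> compact_space (subtopology ?H ?C)"
    using not_closed compactin_imp_closedin[of ?H ?C]
    by (auto simp: compactin_subspace topspace_hit_or_miss_topology convex_closed_subsets_def)

  \<comment> \<open>Convergence in the weak topology and strictness of the comparison\<close>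
  \<comment> \<open>An upset containing the least point is all of \<open>X\<close>. A clopen set
    without \<open>x\<close> is finite, and a nonempty upset contains the greatest point.\<close>
  have upset: "V = {} \<or> V = X \<or> finite V \<and> z \<in> V" if V: "clopenin T V" "upset_in X r V" for V
  proof (cases "x \<in> V")
    case True
    then have "V = X" using V(2) least by (auto simp: upset_in_def)
    then show ?thesis by simp
  next
    case False
    then show ?thesis using V greatest mem(2) by (auto simp: clopen upset_in_def)
  qed
  have weak_lim: "limitin (weak_hit_or_miss_topology T r) (\<lambda>n. {y n, z}) X sequentially"
    unfolding weak_hit_or_miss_topology_def
  proof (rule limitin_topology_generated_by, goal_cases)
    case 1
    show ?case
      using topspace_weak_hit_or_miss_topology[of T r] XC
      unfolding weak_hit_or_miss_topology_def topology_generated_by_topspace by simp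
  next
    case (2 S)
    note XS = 2(2)
    from 2(1) obtain V where V: "clopenin T V" "upset_in X r V"
      and S: "S \<in> {miss T V \<inter> ?C, miss T (X - V) \<inter> ?C, hit T V \<inter> ?C, hit T (X - V) \<inter> ?C}"
      unfolding top by blast
    have VX: "V \<subseteq> X" using V(2) by (simp add: upset_in_def)
    consider "V = {}" | "V = X" | "V \<noteq> {}" "V \<noteq> X" "finite V" "z \<in> V" using upset[OF V] by blast
    then show ?case
    proof cases
      \<comment> \<open>For the two trivial upsets, a generator containing \<open>X\<close> demands
        at most that a set be nonempty.\<close>
      case 1
      from conv_ev show ?thesis
        by eventually_elim
          (use S XS 1 mem in \<open>auto simp: hit_def miss_def convex_closed_subsets_def closed_subsets_def cl\<close>)
    next
      case 2
      from conv_ev show ?thesis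
        by eventually_elim
          (use S XS 2 mem in \<open>auto simp: hit_def miss_def convex_closed_subsets_def closed_subsets_def cl\<close>)
    next
      \<comment> \<open>Now \<open>X\<close> meets both \<open>V\<close> and \<open>X - V\<close>,
        so \<open>S\<close> is one of the two hit generators. The pair hits \<open>V\<close> at
        \<open>z\<close>, and hits \<open>X - V\<close> at \<open>y n\<close> once
        \<open>y n\<close> has left the finite set \<open>V\<close>.\<close>
      case 3
      from avoid[OF 3(3)] conv_ev eventually_ge_at_top[of 1] show ?thesis
        by eventually_elim
          (use S XS VX 3 mem in \<open>auto simp: hit_def miss_def convex_closed_subsets_def\<close>)
    qed
  qed
  have "strictly_finer (subtopology ?H ?C) (weak_hit_or_miss_topology T r)"
    unfolding strictly_finer_def
  proof (intro conjI allI impI exI)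
    show "topspace (subtopology ?H ?C) = topspace (weak_hit_or_miss_topology T r)"
      by (auto simp: topspace_hit_or_miss_topology topspace_weak_hit_or_miss_topology convex_closed_subsets_def)
    show "openin (subtopology ?H ?C) U" if "openin (weak_hit_or_miss_topology T r) U" for U
      using openin_weak_imp_openin_hit_or_miss[OF compact that] .
    \<comment> \<open>Only \<open>x\<close> fails to be isolated, so this singleton is open. It is
      not an upset, and its complement contains \<open>x\<close> without being an upset
      either.\<close>
    have "openin T {y 1}" using mem(3)[of 1] distinct(2)[of 1] by (auto simp: op)
    then show "openin (subtopology ?H ?C) (hit T {y 1} \<inter> ?C)"
      using openin_hit by (auto simp: openin_subtopology)
    show "\<not> openin (weak_hit_or_miss_topology T r) (hit T {y 1} \<inter> ?C)"
    proof
      assume "openin (weak_hit_or_miss_topology T r) (hit T {y 1} \<inter> ?C)"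
      moreover have "X \<in> hit T {y 1} \<inter> ?C"
        using XC mem(3)[of 1] by (auto simp: hit_def convex_closed_subsets_def)
      ultimately have "eventually (\<lambda>n. {y n, z} \<in> hit T {y 1} \<inter> ?C) sequentially"
        using weak_lim unfolding limitin_def by blast
      \<comment> \<open>As \<open>z\<close> differs from \<open>y 1\<close>, the pair could hit
        \<open>{y 1}\<close> only through \<open>y n\<close>, which \<open>avoid\<close> excludes
        for large \<open>n\<close>.\<close>
      moreover have "eventually (\<lambda>n. y n \<notin> {y 1}) sequentially" by (rule avoid) simp
      ultimately have "eventually (\<lambda>n::nat. False) sequentially"
        by eventually_elim (use distinct(3)[of 1] in \<open>auto simp: hit_def\<close>)
      then show False by simp
    qed
  qed
  then show ?thesis
    using clopen priestley not_closed not_compact by blast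
qed

end
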